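(* Let $(\xi,\alpha,\Phi)$ be a Sasakian structure on a finite-dimensional real Lie algebra $(\mathfrak g,[\cdot,\cdot])$. Let $D\in\operatorname{Der}(\mathfrak g)$ be such that $\alpha\circ D=\alpha$, and assume that $(\Phi\circ D-D\circ\Phi)|_{\operatorname{Ker}(\alpha)}=0$. Consider the Lie algebra $\mathfrak g(D)=\langle D\rangle\ltimes\mathfrak g$, and let $x_P\in\mathfrak g(D)$ be the adjoined element, so that $[x_P,x]=D(x)$ for every $x\in\mathfrak g$ and $\mathfrak g(D)=\langle x_P\rangle\oplus\mathfrak g$. Define $J:\mathfrak g(D)\to\mathfrak g(D)$ by $J(x)=\Phi(x)+\alpha(x)\,x_P$ for $x\in\mathfrak g$ and $J(x_P)=-\xi$, and define $\bar\alpha=\alpha+x_P^*\in\mathfrak g(D)^*$. Then $(\mathfrak g(D),\bar\alpha)$ is a Frobenius-Kähler Lie algebra.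
   Context: Convention: $d\alpha(x,y)=-\alpha([x,y])$ for a linear form $\alpha$ on a Lie algebra. Extension by a derivation: $\mathfrak g(D)=\langle D\rangle\oplus\mathfrak g$ with the bracket of $\mathfrak g$ on $\mathfrak g$ and $[D,x]=D(x)$ for $x\in\mathfrak g$. The form $\alpha$ is extended to $\mathfrak g(D)$ by $\alpha(x_P)=0$, and $x_P^*$ is the functional with $x_P^*(x_P)=1$, $x_P^*(\mathfrak g)=0$. Sasakian structure: a triple $(\xi,\alpha,\Phi)$ on a real Lie algebra $\mathfrak g$, with $\xi\in\mathfrak g$, $\alpha\in\mathfrak g^*$, $\Phi\in\operatorname{End}(\mathfrak g)$, such that there is a positive-definite symmetric bilinear form $g$ on $\mathfrak g$ with: $\alpha(\xi)=1$; $\Phi^2=-\operatorname{Id}+\alpha\otimes\xi$; $g(\Phi x,\Phi y)=g(x,y)-\alpha(x)\alpha(y)$; $g(x,\Phi y)=d\alpha(x,y)$; and $N_\Phi=-d\alpha\otimes\xi$, where $N_\Phi(x,y)=\Phi^2[x,y]+[\Phi x,\Phi y]-\Phi[x,\Phi y]-\Phi[\Phi x,y]$. Kähler structure: a pair $(K,\omega)$ on a real Lie algebra such that there is a positive-definite symmetric bilinear form $g$ with: $K$ a linear endomorphism, $K^2=-\operatorname{Id}$; $g(Kx,y)+g(x,Ky)=0$; $N_K=0$, where $N_K(x,y)=-[x,y]+[Kx,Ky]-K[x,Ky]-K[Kx,y]$; $\omega(x,y)=g(x,Ky)$; and $d\omega=0$. A pair $(\mathfrak k,\beta)$, with $\mathfrak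 k$ a real Lie algebra and $\beta\in\mathfrak k^*$, is a Frobenius-Kähler Lie algebra if $\mathfrak k$ carries a Kähler structure $(K,\omega)$ whose symplectic form is $\omega=-d\beta$ (i.e. $\omega(x,y)=\beta([x,y])$). *)

theory Defs
  imports "HOL-Analysis.Analysis"
begin

text \<open>A real Lie algebra is a real vector space (a type of class \<open>real_vector\<close>) together with
  a bracket \<open>br\<close>. Linear forms and bilinear forms are real-valued functions.\<close>

definition lie_algebra :: "('a::real_vector \<Rightarrow> 'a \<Rightarrow> 'a) \<Rightarrow> bool" where
  "lie_algebra br \<longleftrightarrow>
     bilinear br \<and>
     (\<forall>x. br x x = 0) \<and>
     (\<forall>x y z. br x (br y z) + br y (br z x) + br z (br x y) = 0)"

definition lie_derivation :: "('a::real_vector \<Rightarrow> 'a \<Rightarrow> 'a) \<Rightarrow> ('a \<Rightarrow> 'a) \<Rightarrow> bool" where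
  "lie_derivation br D \<longleftrightarrow>
     linear D \<and> (\<forall>x y. D (br x y) = br (D x) y + br x (D y))"

definition finite_dim :: "'a::real_vector itself \<Rightarrow> bool" where
  "finite_dim _ \<longleftrightarrow> (\<exists>B::'a set. finite B \<and> span B = UNIV)"

text \<open>The Lie algebra differential of 1-forms and of 2-forms, with the sign convention
  \<open>d\<alpha>(x,y) = -\<alpha>([x,y])\<close>.\<close>

definition ext_deriv1 :: "('a \<Rightarrow> 'a \<Rightarrow> 'a) \<Rightarrow> ('a \<Rightarrow> real) \<Rightarrow> 'a \<Rightarrow> 'a \<Rightarrow> real" where
  "ext_deriv1 br \<alpha> x y = - \<alpha> (br x y)"

definition ext_deriv2 :: "('a \<Rightarrow> 'a \<Rightarrow> 'a) \<Rightarrow> ('a \<Rightarrow> 'a \<Rightarrow> real) \<Rightarrow> 'a \<Rightarrow> 'a \<Rightarrow> 'a \<Rightarrow> real" where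
  "ext_deriv2 br \<omega> x y z = - \<omega> (br x y) z - \<omega> (br y z) x - \<omega> (br z x) y"

definition pos_def_form :: "('a::real_vector \<Rightarrow> 'a \<Rightarrow> real) \<Rightarrow> bool" where
  "pos_def_form g \<longleftrightarrow>
     bilinear g \<and> (\<forall>x y. g x y = g y x) \<and> (\<forall>x. x \<noteq> 0 \<longrightarrow> g x x > 0)"

text \<open>The Nijenhuis torsion of an endomorphism. The second version is the one used for almost
  complex structures; the two agree when \<open>T\<^sup>2 = -Id\<close>.\<close>

definition nijenhuis :: "('a::real_vector \<Rightarrow> 'a \<Rightarrow> 'a) \<Rightarrow> ('a \<Rightarrow> 'a) \<Rightarrow> 'a \<Rightarrow> 'a \<Rightarrow> 'a" where
  "nijenhuis br T x y =
     T (T (br x y)) + br (T x) (T y) - T (br x (T y)) - T (br (T x) y)"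

definition nijenhuis_complex ::
    "('a::real_vector \<Rightarrow> 'a \<Rightarrow> 'a) \<Rightarrow> ('a \<Rightarrow> 'a) \<Rightarrow> 'a \<Rightarrow> 'a \<Rightarrow> 'a" where
  "nijenhuis_complex br K x y =
     - br x y + br (K x) (K y) - K (br x (K y)) - K (br (K x) y)"

definition sasakian_structure ::
    "('a::real_vector \<Rightarrow> 'a \<Rightarrow> 'a) \<Rightarrow> 'a \<Rightarrow> ('a \<Rightarrow> real) \<Rightarrow> ('a \<Rightarrow> 'a) \<Rightarrow> bool" where
  "sasakian_structure br \<xi> \<alpha> \<Phi> \<longleftrightarrow>
     lie_algebra br \<and> linear \<alpha> \<and> linear \<Phi> \<and>
     (\<exists>g. pos_def_form g \<and>
        \<alpha> \<xi> = 1 \<and>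
        (\<forall>x. \<Phi> (\<Phi> x) = - x + \<alpha> x *\<^sub>R \<xi>) \<and>
        (\<forall>x y. g (\<Phi> x) (\<Phi> y) = g x y - \<alpha> x * \<alpha> y) \<and>
        (\<forall>x y. g x (\<Phi> y) = ext_deriv1 br \<alpha> x y) \<and>
        (\<forall>x y. nijenhuis br \<Phi> x y = - (ext_deriv1 br \<alpha> x y *\<^sub>R \<xi>)))"

definition kaehler_structure ::
    "('a::real_vector \<Rightarrow> 'a \<Rightarrow> 'a) \<Rightarrow> ('a \<Rightarrow> 'a) \<Rightarrow> ('a \<Rightarrow> 'a \<Rightarrow> real) \<Rightarrow> bool" where
  "kaehler_structure br K \<omega> \<longleftrightarrow>
     lie_algebra br \<and>
     (\<exists>g. pos_def_form g \<and>
        linear K \<and>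
        (\<forall>x. K (K x) = - x) \<and>
        (\<forall>x y. g (K x) y + g x (K y) = 0) \<and>
        (\<forall>x y. nijenhuis_complex br K x y = 0) \<and>
        (\<forall>x y. \<omega> x y = g x (K y)) \<and>
        (\<forall>x y z. ext_deriv2 br \<omega> x y z = 0))"

definition frobenius_kaehler :: "('a::real_vector \<Rightarrow> 'a \<Rightarrow> 'a) \<Rightarrow> ('a \<Rightarrow> real) \<Rightarrow> bool" where
  "frobenius_kaehler br \<beta> \<longleftrightarrow>
     lie_algebra br \<and> linear \<beta> \<and>
     (\<exists>K \<omega>. kaehler_structure br K \<omega> \<and> (\<forall>x y. \<omega> x y = - ext_deriv1 br \<beta> x y))"

text \<open>The extension \<open>\<g>(D)\<close> has underlying space \<open>real \<times> 'a\<close>: the pair \<open>(t, x)\<close> stands for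
  \<open>t x\<^sub>P + x\<close>, where \<open>x\<^sub>P\<close> is the adjoined element.\<close>

definition ext_bracket ::
    "('a::real_vector \<Rightarrow> 'a \<Rightarrow> 'a) \<Rightarrow> ('a \<Rightarrow> 'a) \<Rightarrow> real \<times> 'a \<Rightarrow> real \<times> 'a \<Rightarrow> real \<times> 'a" where
  "ext_bracket br D u v =
     (0, br (snd u) (snd v) + fst u *\<^sub>R D (snd v) - fst v *\<^sub>R D (snd u))"

definition ext_incl :: "'a::real_vector \<Rightarrow> real \<times> 'a" where
  "ext_incl x = (0, x)"

definition x_P :: "real \<times> 'a::real_vector" where
  "x_P = (1, 0)"

definition x_P_dual :: "real \<times> 'a::real_vector \<Rightarrow> real" where
  "x_P_dual u = fst u"

text \<open>Extension of a linear form by \<open>\<alpha>(x\<^sub>P) = 0\<close>.\<close>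

definition ext_form :: "('a::real_vector \<Rightarrow> real) \<Rightarrow> real \<times> 'a \<Rightarrow> real" where
  "ext_form \<alpha> u = \<alpha> (snd u)"

end

theory Submission
  imports Defs
begin

text \<open>On \<open>real \<times> 'a\<close> take the orthogonal sum \<open>t s + g x y\<close> of the Sasakian metric with the
  standard metric on the line of \<open>x_P\<close>. The endomorphism \<open>K\<close> relating it to the symplectic form
  \<open>\<alpha>bar ([u, v])\<close> is forced: \<open>K (t, x) = (\<alpha> x, - \<Phi> x - t \<xi>)\<close>. Note that \<open>K\<close> differs from \<open>J\<close>
  by the sign of \<open>\<Phi>\<close>: under \<open>J\<close> the form \<open>\<omega>(u, J v)\<close> is symmetric, but it equals
  \<open>g x y - 2 \<alpha> x \<alpha> y - t s\<close>, which is indefinite as soon as \<open>Ker \<alpha>\<close> is nonzero. For either sign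
  the torsion reduces to that of \<open>\<Phi>\<close> once \<open>D\<close> commutes with \<open>\<Phi>\<close> everywhere, and
  this holds because \<open>D \<xi> = \<xi>\<close>: the vector \<open>D \<xi> - \<xi>\<close> lies in \<open>Ker \<alpha>\<close> and in the radical of \<open>d\<alpha>\<close>.\<close>

lemma lie_algebra_skew:
  assumes "lie_algebra br"
  shows "br y x = - br x y"
proof -
  have b: "bilinear br" and z: "\<And>x. br x x = 0"
    using assms by (auto simp: lie_algebra_def)
  show ?thesis
    using z[of "x + y"] z[of x] z[of y]
    by (simp add: bilinear_ladd[OF b] bilinear_radd[OF b] add.commute eq_neg_iff_add_eq_0)
qed

text \<open>Sorted by the coefficients along \<open>x_P\<close>, the Jacobi sum splits into the
  Jacobi identity of \<open>br\<close> and the Leibniz rule of \<open>D\<close>; the remaining terms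
  cancel in pairs.\<close>

lemma lie_algebra_ext_bracket:
  assumes L: "lie_algebra br" and D: "lie_derivation br D"
  shows "lie_algebra (ext_bracket br D)"
proof -
  have b: "bilinear br" and z: "\<And>x. br x x = 0"
    and jac: "\<And>x y z. br x (br y z) + br y (br z x) + br z (br x y) = 0"
    using L by (auto simp: lie_algebra_def)
  have lD: "linear D" and der: "\<And>x y. D (br x y) = br (D x) y + br x (D y)"
    using D by (auto simp: lie_derivation_def)
  note lin = bilinear_ladd[OF b] bilinear_radd[OF b] bilinear_lsub[OF b] bilinear_rsub[OF b]
    bilinear_lmul[OF b] bilinear_rmul[OF b] linear_add[OF lD] linear_diff[OF lD]
    linear_cmul[OF lD] der
  have "bilinear (ext_bracket br D)"
    unfolding bilinear_def
    by (auto intro!: linearI simp: ext_bracket_def lin algebra_simps)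
  moreover have "ext_bracket br D u u = 0" for u
    by (simp add: ext_bracket_def z zero_prod_def)
  moreover have "ext_bracket br D u (ext_bracket br D v w) + ext_bracket br D v (ext_bracket br D w u)
      + ext_bracket br D w (ext_bracket br D u v) = 0" for u v w
  proof -
    obtain t x s y r z where [simp]: "u = (t, x)" "v = (s, y)" "w = (r, z)"
      by (metis surj_pair)
    have "br z x = - br x z" "br (D y) x = - br x (D y)" "br (D z) x = - br x (D z)"
         "br (D z) y = - br y (D z)" "br (D x) y = - br y (D x)" "br (D x) z = - br z (D x)"
         "br (D y) z = - br z (D y)"
      by (rule lie_algebra_skew[OF L])+
    \<comment> \<open>The first equation is left out so that \<open>br z x\<close> keeps the
      orientation it has in \<open>jac\<close>; the others move \<open>D\<close> to the second
      slot.\<close>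
    note sk = this(2-)
    show ?thesis
      using jac[of x y z]
      by (simp add: ext_bracket_def lin sk zero_prod_def algebra_simps)
  qed
  ultimately show ?thesis
    by (simp add: lie_algebra_def)
qed

text \<open>The cyclic sum is \<beta> applied to the Jacobi identity. This gives closedness of the
  symplectic form.\<close>

lemma ext_deriv2_exact:
  assumes "lie_algebra br" and l: "linear \<beta>"
  shows "ext_deriv2 br (\<lambda>u v. \<beta> (br u v)) x y z = 0"
proof -
  have "br x (br y z) + br y (br z x) + br z (br x y) = 0"
    using assms by (simp add: lie_algebra_def)
  then have "\<beta> (br x (br y z)) + \<beta> (br y (br z x)) + \<beta> (br z (br x y)) = 0"
    by (metis linear_0[OF l] linear_add[OF l])
  moreover have "\<beta> (br (br u v) w) = - \<beta> (br w (br u v))" for u v w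
    by (metis lie_algebra_skew[OF assms(1)] linear_neg[OF l])
  ultimately show ?thesis
    by (simp add: ext_deriv2_def)
qed

text \<open>Both follow from evaluating the cube of \<Phi> in two ways, first at \<xi> and then at
  x.\<close>

lemma almost_contact_identities:
  assumes lP: "linear \<Phi>" and la: "linear \<alpha>" and a1: "\<alpha> \<xi> = 1"
    and P2: "\<And>x. \<Phi> (\<Phi> x) = - x + \<alpha> x *\<^sub>R \<xi>"
  shows "\<Phi> \<xi> = 0" "\<alpha> (\<Phi> x) = 0"
proof -
  have P2xi: "\<Phi> (\<Phi> \<xi>) = 0"
    using assms by simp
  define c where "c = \<alpha> (\<Phi> \<xi>)"
  have e: "\<Phi> \<xi> = c *\<^sub>R \<xi>"
    using P2[of "\<Phi> \<xi>"] P2xi by (simp add: linear_0[OF lP] c_def)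
  then have "(c * c) *\<^sub>R \<xi> = 0"
    using P2xi by (simp add: linear_cmul[OF lP])
  then show xi: "\<Phi> \<xi> = 0"
    using e by auto
  have "\<Phi> (- x + \<alpha> x *\<^sub>R \<xi>) = - \<Phi> x + \<alpha> (\<Phi> x) *\<^sub>R \<xi>"
    using P2 by metis
  then have *: "\<alpha> (\<Phi> x) *\<^sub>R \<xi> = 0"
    by (simp add: linear_diff[OF lP] linear_cmul[OF lP] xi)
  show "\<alpha> (\<Phi> x) = 0"
    using * a1 linear_0[OF la] by auto
qed

theorem theorem4p2:
  fixes br :: "'a::real_vector \<Rightarrow> 'a \<Rightarrow> 'a"
    and \<xi> :: 'a
    and \<alpha> :: "'a \<Rightarrow> real"
    and \<Phi> D :: "'a \<Rightarrow> 'a"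
    and J :: "real \<times> 'a \<Rightarrow> real \<times> 'a"
    and \<alpha>bar :: "real \<times> 'a \<Rightarrow> real"
  assumes "finite_dim TYPE('a)"
    and "lie_algebra br"
    and "sasakian_structure br \<xi> \<alpha> \<Phi>"
    and "lie_derivation br D"
    and "\<forall>x. \<alpha> (D x) = \<alpha> x"
    and "\<forall>x. \<alpha> x = 0 \<longrightarrow> \<Phi> (D x) - D (\<Phi> x) = 0"
    and "linear J"
    and "\<forall>x. J (ext_incl x) = ext_incl (\<Phi> x) + \<alpha> x *\<^sub>R x_P"
    and "J x_P = - ext_incl \<xi>"
    and "\<forall>u. \<alpha>bar u = ext_form \<alpha> u + x_P_dual u"
  shows "frobenius_kaehler (ext_bracket br D) \<alpha>bar"
proof -
  let ?br = "ext_bracket br D"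
  obtain g where g: "pos_def_form g" and a1: "\<alpha> \<xi> = 1"
    and P2: "\<And>x. \<Phi> (\<Phi> x) = - x + \<alpha> x *\<^sub>R \<xi>"
    and gP: "\<And>x y. g (\<Phi> x) (\<Phi> y) = g x y - \<alpha> x * \<alpha> y"
    and ga: "\<And>x y. g x (\<Phi> y) = - \<alpha> (br x y)"
    and N: "\<And>x y. nijenhuis br \<Phi> x y = \<alpha> (br x y) *\<^sub>R \<xi>"
    and la: "linear \<alpha>" and lP: "linear \<Phi>"
    using assms(3) by (auto simp: sasakian_structure_def ext_deriv1_def)
  have gb: "bilinear g" and gsym: "\<And>x y. g x y = g y x" and gpos: "\<And>x. x \<noteq> 0 \<Longrightarrow> g x x > 0"
    using g unfolding pos_def_form_def by blast+
  have b: "bilinear br"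
    using assms(2) by (simp add: lie_algebra_def)
  have lD: "linear D" and der: "\<And>x y. D (br x y) = br (D x) y + br x (D y)"
    using assms(4) by (auto simp: lie_derivation_def)
  have aD: "\<And>x. \<alpha> (D x) = \<alpha> x"
    using assms(5) by simp
  have Pxi: "\<Phi> \<xi> = 0" and aP: "\<And>x. \<alpha> (\<Phi> x) = 0"
    using almost_contact_identities[OF lP la a1 P2] by auto
  have gxi: "g x \<xi> = \<alpha> x" for x
    using gP[of x \<xi>] by (simp add: Pxi a1 bilinear_rzero[OF gb])
  have skew: "br y x = - br x y" for x y
    by (rule lie_algebra_skew[OF assms(2)])
  have axi: "\<alpha> (br x \<xi>) = 0" for x
    using ga[of x \<xi>] by (simp add: Pxi bilinear_rzero[OF gb])
  have xixi: "br \<xi> \<xi> = 0"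
    using assms(2) by (simp add: lie_algebra_def)
  have Dxi: "D \<xi> = \<xi>"
  proof -
    let ?z = "D \<xi> - \<xi>"
    have "\<alpha> (br x (D \<xi>)) = 0" for x
      using axi[of "D x"] axi[of x] aD[of "br x \<xi>"] by (simp add: der linear_add[OF la])
    \<comment> \<open>By \<open>ga\<close>, this is d\<alpha> of \<open>\<Phi> ?z\<close> and
      \<open>?z\<close>, so positivity of g makes d\<alpha> nondegenerate on Ker \<alpha>.\<close>
    then have "g (\<Phi> ?z) (\<Phi> ?z) = 0"
      by (simp add: ga axi bilinear_rsub[OF b] linear_diff[OF la])
    then have "\<Phi> ?z = 0"
      using gpos by force
    then have "\<Phi> (\<Phi> ?z) = 0"
      by (simp add: linear_0[OF lP])
    then show ?thesis
      by (simp add: P2 linear_diff[OF la] aD)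
  qed
  have comm: "\<Phi> (D x) = D (\<Phi> x)" for x
  proof -
    \<comment> \<open>Project to Ker \<alpha> along \<xi>; on the line of \<xi> both composites
      vanish.\<close>
    let ?x = "x - \<alpha> x *\<^sub>R \<xi>"
    have "\<alpha> ?x = 0"
      by (simp add: linear_diff[OF la] linear_cmul[OF la] a1)
    then have "\<Phi> (D ?x) - D (\<Phi> ?x) = 0"
      using assms(6) by blast
    then show ?thesis
      by (simp add: linear_diff[OF lD] linear_cmul[OF lD] linear_diff[OF lP] linear_cmul[OF lP]
          Pxi Dxi)
  qed
  have aPP: "\<alpha> (br (\<Phi> x) y) + \<alpha> (br x (\<Phi> y)) = 0" for x y
  proof -
    have "\<alpha> (br y (\<Phi> x)) = \<alpha> (br x (\<Phi> y))"
      using ga[of y "\<Phi> x"] ga[of x "\<Phi> y"]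
      by (simp add: P2 bilinear_rsub[OF gb] bilinear_rmul[OF gb] gxi gsym[of y x] mult.commute)
    then show ?thesis
      using skew[of "\<Phi> x" y] by (simp add: linear_neg[OF la])
  qed
  \<comment> \<open>The \<xi>-term of \<Phi> squared cancels the right-hand side of
    \<open>N\<close>.\<close>
  have torsion: "- br x y + br (\<Phi> x) (\<Phi> y) - \<Phi> (br x (\<Phi> y)) - \<Phi> (br (\<Phi> x) y) = 0" for x y
    using N[of x y] by (simp add: nijenhuis_def P2 algebra_simps)
  \<comment> \<open>Bracketing with \<xi> commutes with \<Phi>: put y = \<xi> in
    \<open>torsion\<close> and apply \<Phi>.\<close>
  have torsion_xi: "\<Phi> (br x \<xi>) = br (\<Phi> x) \<xi>" for x
  proof -
    have "- br x \<xi> = \<Phi> (br (\<Phi> x) \<xi>)"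
      using torsion[of x \<xi>]
      by (simp add: Pxi bilinear_rzero[OF b] linear_0[OF lP])
    then have "- \<Phi> (br x \<xi>) = \<Phi> (\<Phi> (br (\<Phi> x) \<xi>))"
      by (metis linear_neg[OF lP])
    then show ?thesis
      by (simp add: P2 axi)
  qed
  have L: "lie_algebra ?br"
    by (rule lie_algebra_ext_bracket[OF assms(2,4)])
  have abar: "\<alpha>bar u = \<alpha> (snd u) + fst u" for u
    using assms(10) unfolding ext_form_def x_P_dual_def by blast
  have lbar: "linear \<alpha>bar"
    by (rule linearI) (simp_all add: abar linear_add[OF la] linear_cmul[OF la] algebra_simps)
  define K where "K = (\<lambda>u::real \<times> 'a. (\<alpha> (snd u), - \<Phi> (snd u) - fst u *\<^sub>R \<xi>))"
  define G where "G = (\<lambda>u v :: real \<times> 'a. fst u * fst v + g (snd u) (snd v))"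
  note lins = bilinear_ladd[OF gb] bilinear_radd[OF gb] bilinear_lsub[OF gb] bilinear_rsub[OF gb]
    bilinear_lmul[OF gb] bilinear_rmul[OF gb] bilinear_lneg[OF gb] bilinear_rneg[OF gb]
    bilinear_ladd[OF b] bilinear_radd[OF b] bilinear_lsub[OF b] bilinear_rsub[OF b]
    bilinear_lmul[OF b] bilinear_rmul[OF b] bilinear_lneg[OF b] bilinear_rneg[OF b]
    linear_add[OF lD] linear_diff[OF lD] linear_cmul[OF lD] linear_neg[OF lD]
    linear_add[OF lP] linear_diff[OF lP] linear_cmul[OF lP] linear_neg[OF lP]
    linear_add[OF la] linear_diff[OF la] linear_cmul[OF la] linear_neg[OF la]
  \<comment> \<open>The mixed terms match because \<alpha> is D-invariant and \<xi> is the g-dual of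
    \<alpha>.\<close>
  have omega: "\<alpha>bar (?br u v) = G u (K v)" for u v
    by (simp add: abar ext_bracket_def G_def K_def lins ga gxi aD algebra_simps)
  have "pos_def_form G"
    unfolding pos_def_form_def
  proof (intro conjI allI impI)
    show "bilinear G"
      unfolding bilinear_def by (auto intro!: linearI simp: G_def lins algebra_simps)
    show "G u v = G v u" for u v
      by (simp add: G_def gsym mult.commute)
    show "G u u > 0" if "u \<noteq> 0" for u
    proof (cases "snd u = 0")
      case True
      then have "fst u \<noteq> 0"
        using that by (simp add: prod_eq_iff)
      then show ?thesis
        using True by (simp add: G_def bilinear_rzero[OF gb] flip: power2_eq_square)
    next
      case False
      then show ?thesis
        using gpos[of "snd u"] by (simp add: G_def add_nonneg_pos)
    qed
  qed
  moreover have "linear K"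
    by (rule linearI) (simp_all add: K_def lins algebra_simps)
  moreover have "K (K u) = - u" for u
    by (simp add: K_def lins P2 Pxi aP a1 prod_eq_iff)
  moreover have "G (K u) v + G u (K v) = 0" for u v
  proof -
    have "G u (K v) = - G v (K u)"
      using lie_algebra_skew[OF L, of u v] by (metis omega linear_neg[OF lbar] minus_minus)
    moreover have "G (K u) v = G v (K u)"
      by (simp add: G_def gsym mult.commute)
    ultimately show ?thesis
      by simp
  qed
  moreover have "nijenhuis_complex ?br K u v = 0" for u v
  proof -
    obtain t x s y where [simp]: "u = (t, x)" "v = (s, y)"
      by (metis surj_pair)
    show ?thesis
      \<comment> \<open>The \<open>x_P\<close> component vanishes by \<open>aPP\<close>. In the
        other component \<open>torsion\<close> settles the part free of t and s, as it is unchanged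
        under \<Phi> to -\<Phi>; \<open>comm\<close> and \<open>torsion_xi\<close> cancel the terms
        with D and \<xi>.\<close>
      using torsion[of x y] aPP[of x y]
      by (simp add: nijenhuis_complex_def ext_bracket_def K_def lins comm aD aP a1 Dxi Pxi P2
          axi torsion_xi skew[of \<xi> y] skew[of \<xi> "\<Phi> y"] xixi prod_eq_iff algebra_simps)
  qed
  ultimately have "kaehler_structure ?br K (\<lambda>u v. \<alpha>bar (?br u v))"
    unfolding kaehler_structure_def
    using L omega ext_deriv2_exact[OF L lbar] by blast
  then show ?thesis
    unfolding frobenius_kaehler_def ext_deriv1_def
    using L lbar by (metis minus_minus)
qed

end
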